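(* Suppose there exists an algorithm which takes as input a Diophantine equation $D(x_1,\ldots,x_p)=0$ and returns an integer $c\geqslant 2$, where $c$ is greater than the number of integer solutions of the equation if the set of integer solutions is finite. Then the question whether or not a Diophantine equation has only finitely many integer solutions is decidable with an oracle for deciding whether or not a Diophantine equation has an integer solution.
   Context: A Diophantine equation is an equation $D(x_1,\ldots,x_p)=0$ with $p\geqslant 1$ and $D\in\mathbb{Z}[x_1,\ldots,x_p]$; the list of variables $x_1,\ldots,x_p$ is part of the data, and an integer solution is a tuple in $\mathbb{Z}^p$. "Decidable with an oracle for" a problem means decidable by an algorithm that may query an oracle answering that problem (Turing reducibility). *)

theory Defs
  imports Complex_Main "HOL-Library.Poly_Mapping" "HOL-Library.Nat_Bijection"
begin

section \<open>Diophantine equations\<close>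

text \<open>
  A polynomial with integer coefficients is a finitely supported map from monomials to
  coefficients, a monomial being a finitely supported map from variable indices to exponents.
  The pair \<open>(p, D)\<close> stands for the equation $D(x_1, \ldots, x_p) = 0$; the variable
  $x_{i+1}$ has index \<open>i\<close>. The number \<open>p\<close> is part of the equation, and \<open>D\<close> need
  not involve all of the \<open>p\<close> variables.
\<close>

type_synonym int_mpoly = "(nat \<Rightarrow>\<^sub>0 nat) \<Rightarrow>\<^sub>0 int"

definition mpoly_eval :: "int_mpoly \<Rightarrow> (nat \<Rightarrow> int) \<Rightarrow> int" where
  "mpoly_eval D x =
     (\<Sum>m\<in>Poly_Mapping.keys D.
        Poly_Mapping.lookup D m *
        (\<Prod>i\<in>Poly_Mapping.keys m. x i ^ Poly_Mapping.lookup m i))"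

definition dioph_eqs :: "(nat \<times> int_mpoly) set" where
  "dioph_eqs =
     {(p, D). p \<ge> 1 \<and> (\<forall>m\<in>Poly_Mapping.keys D. Poly_Mapping.keys m \<subseteq> {..<p})}"

definition int_solutions :: "nat \<times> int_mpoly \<Rightarrow> int list set" where
  "int_solutions = (\<lambda>(p, D). {x. length x = p \<and> mpoly_eval D ((!) x) = 0})"

text \<open>
  Goedel numbers: a monomial in \<open>p\<close> variables is coded by its exponent vector, and a polynomial
  by its finite set of (monomial, nonzero coefficient) pairs. Every equation thus has exactly one
  code.
\<close>

definition monom_code :: "nat \<Rightarrow> (nat \<Rightarrow>\<^sub>0 nat) \<Rightarrow> nat" where
  "monom_code p m = list_encode (map (Poly_Mapping.lookup m) [0..<p])"

definition eq_code :: "nat \<times> int_mpoly \<Rightarrow> nat" where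
  "eq_code = (\<lambda>(p, D). prod_encode (p, set_encode
     ((\<lambda>m. prod_encode (monom_code p m, int_encode (Poly_Mapping.lookup D m))) `
        Poly_Mapping.keys D)))"

lemma monom_code_inj:
  assumes "Poly_Mapping.keys m \<subseteq> {..<p}" "Poly_Mapping.keys m' \<subseteq> {..<p}"
    and "monom_code p m = monom_code p m'"
  shows "m = m'"
proof (rule poly_mapping_eqI)
  fix i
  have eq: "map (Poly_Mapping.lookup m) [0..<p] = map (Poly_Mapping.lookup m') [0..<p]"
    using assms(3) by (simp add: monom_code_def list_encode_eq)
  show "Poly_Mapping.lookup m i = Poly_Mapping.lookup m' i"
  proof (cases "i < p")
    case True
    then show ?thesis using eq by simp
  next
    case False
    then have "i \<notin> Poly_Mapping.keys m" "i \<notin> Poly_Mapping.keys m'"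
      using assms(1,2) by auto
    then show ?thesis by (simp add: in_keys_iff)
  qed
qed

lemma inj_on_eq_code: "inj_on eq_code dioph_eqs"
proof (rule inj_onI, clarify)
  fix p D q E
  assume D: "(p, D) \<in> dioph_eqs" and E: "(q, E) \<in> dioph_eqs"
    and eq: "eq_code (p, D) = eq_code (q, E)"
  define F where
    "F = (\<lambda>D m. prod_encode (monom_code p m, int_encode (Poly_Mapping.lookup (D::int_mpoly) m)))"
  have pq: "p = q" using eq by (simp add: eq_code_def)
  have sets: "F D ` Poly_Mapping.keys D = F E ` Poly_Mapping.keys E"
    using eq by (simp add: eq_code_def F_def set_encode_eq pq)
  have vars: "Poly_Mapping.keys m \<subseteq> {..<p}"
    if "m \<in> Poly_Mapping.keys D \<union> Poly_Mapping.keys E" for m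
    using that D E pq by (auto simp: dioph_eqs_def)
  have sub: "m \<in> Poly_Mapping.keys B \<and> Poly_Mapping.lookup A m = Poly_Mapping.lookup B m"
    if m: "m \<in> Poly_Mapping.keys A" and im: "F A ` Poly_Mapping.keys A = F B ` Poly_Mapping.keys B"
      and AB: "A = D \<and> B = E \<or> A = E \<and> B = D" for A B m
  proof -
    obtain m' where m': "m' \<in> Poly_Mapping.keys B" "F A m = F B m'"
      using m im by (metis imageE imageI)
    then have "monom_code p m = monom_code p m'"
      and c: "Poly_Mapping.lookup A m = Poly_Mapping.lookup B m'"
      by (simp_all add: F_def int_encode_eq)
    then have "m = m'" using vars[of m] vars[of m'] m AB m'(1) monom_code_inj by blast
    then show ?thesis using m' c by simp
  qed
  have "D = E"
  proof (rule poly_mapping_eqI)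
    fix m
    show "Poly_Mapping.lookup D m = Poly_Mapping.lookup E m"
      using sub[of m D E] sub[of m E D] sets by (metis in_keys_iff)
  qed
  with pq show "p = q \<and> D = E" by simp
qed


section \<open>Relative computability\<close>

text \<open>
  Kleene's partial recursive functions relative to a set \<open>A\<close> of natural numbers:
  \<^const>\<open>None\<close> stands for divergence. The programs are untyped with respect to arity, so a call
  with an unsuitable number of arguments also counts as divergence.
\<close>

datatype recf =
    Zero
  | Succ
  | Proj nat
  | Query
  | Comp recf "recf list"
  | PrimRec recf recf
  | Mu recf

fun run :: "nat set \<Rightarrow> recf \<Rightarrow> nat list \<Rightarrow> nat option" where
  "run A Zero xs = Some 0"
| "run A Succ xs = (case xs of [x] \<Rightarrow> Some (Suc x) | _ \<Rightarrow> None)"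
| "run A (Proj i) xs = (if i < length xs then Some (xs ! i) else None)"
| "run A Query xs = (case xs of [x] \<Rightarrow> Some (if x \<in> A then 1 else 0) | _ \<Rightarrow> None)"
| "run A (Comp f gs) xs = Option.bind (those (map (\<lambda>g. run A g xs) gs)) (run A f)"
| "run A (PrimRec f g) xs =
     (case xs of
        [] \<Rightarrow> None
      | n # ys \<Rightarrow>
          rec_nat (run A f ys) (\<lambda>k r. Option.bind r (\<lambda>y. run A g (k # y # ys))) n)"
| "run A (Mu f) xs =
     (if \<exists>n. run A f (n # xs) = Some 0 \<and> (\<forall>k<n. run A f (k # xs) \<noteq> None)
      then Some (LEAST n. run A f (n # xs) = Some 0)
      else None)"

text \<open>Programs without queries compute the ordinary partial recursive functions.\<close>

fun query_free :: "recf \<Rightarrow> bool" where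
  "query_free Query = False"
| "query_free (Comp f gs) = (query_free f \<and> (\<forall>g\<in>set gs. query_free g))"
| "query_free (PrimRec f g) = (query_free f \<and> query_free g)"
| "query_free (Mu f) = query_free f"
| "query_free _ = True"

text \<open>\<open>S\<close> is decidable relative to \<open>A\<close>, i.e. \<open>S\<close> is Turing reducible to \<open>A\<close>.\<close>

definition decidable_relative_to :: "nat set \<Rightarrow> nat set \<Rightarrow> bool" where
  "decidable_relative_to A S \<longleftrightarrow>
     (\<exists>r. \<forall>n. run A r [n] = Some (if n \<in> S then 1 else 0))"

definition solvable_codes :: "nat set" where
  "solvable_codes = eq_code ` {e \<in> dioph_eqs. int_solutions e \<noteq> {}}"

definition finitely_solvable_codes :: "nat set" where
  "finitely_solvable_codes = eq_code ` {e \<in> dioph_eqs. finite (int_solutions e)}"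

text \<open>
  A program computing, from the code of a Diophantine equation, a number \<open>c \<ge> 2\<close> that exceeds
  the number of integer solutions if there are only finitely many. It need not halt on numbers
  that are not codes; since it is query-free, the set passed to \<^const>\<open>run\<close> is immaterial.
\<close>

definition computes_solution_bound :: "recf \<Rightarrow> bool" where
  "computes_solution_bound r \<longleftrightarrow>
     query_free r \<and>
     (\<forall>e\<in>dioph_eqs. \<exists>c. run {} r [eq_code e] = Some c \<and> c \<ge> 2 \<and>
        (finite (int_solutions e) \<longrightarrow> card (int_solutions e) < c))"

end

theory Submission
  imports Defs
begin

text \<open>
  Let $c$ be the bound computed for the equation $D(x_1, \ldots, x_p) = 0$. A finite solution set
  has fewer than $c$ elements, and an infinite one has at least $c$. Hence the solution set is
  infinite if and only if there are $c$ distinct solutions, and this is again the solvability of a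
  Diophantine equation: take $c$ blocks $x^{(0)}, \ldots, x^{(c-1)}$ of $p$ fresh variables and two
  more variables $a, b$, and consider
  \[ \sum_i D(x^{(i)})^2 + \Bigl( \prod_{j < i} \sum_k (x^{(i)}_k - x^{(j)}_k)^2
        - (2a + 1)(3b + 1) \Bigr)^2 = 0. \]
  An integer is nonzero if and only if it is of the form $(2a + 1)(3b + 1)$
  (\<open>nonzero_iff_product_form\<close>), so the second square can vanish exactly if the blocks are pairwise
  distinct (\<open>many_solutions_poly_solvable_iff\<close>, \<open>finitely_solvable_iff\<close>). One query for this
  equation decides whether the solution set of $D$ is finite.

  What remains is that the code of the new equation is a computable function of $c$ and of the code
  of $D$. Partial recursive programs for this are never written down. Instead, \<open>computable\<close> is
  defined for functions between arbitrary types with an encoding and is shown to be closed under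
  recursion on numbers, case distinction and folds over lists. Polynomials are represented by
  unsorted lists of terms, on which the ring operations are compositions of maps and
  concatenations, so that their computability follows by applying closure rules. Only at the
  end are like terms merged, which produces the canonical code of the equation
  (\<open>poly_code_eq\<close>).

  Two points concern inputs. Numbers that are not codes of equations have to be rejected; they
  are recognised by decoding and encoding again (\<open>valid_code_iff\<close>). The bounding program may
  diverge on them, so it is run on a fixed code instead.
\<close>

section \<open>Computable functions between coded types\<close>

text \<open>
  Computability is defined on numbers, but the construction below is a function on lists of pairs
  of exponent lists and integers. Pairs, lists and integers get the encoding that the Goedel numbers
  use, so that coding and decoding are the identity on the level of numbers.
\<close>

class coded =
  fixes enc :: "'a \<Rightarrow> nat"
  assumes enc_inject: "enc x = enc y \<longleftrightarrow> x = y"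

instantiation nat :: coded
begin
definition enc_nat :: "nat \<Rightarrow> nat" where [simp]: "enc_nat n = n"
instance by standard simp
end

instantiation bool :: coded
begin
definition enc_bool :: "bool \<Rightarrow> nat" where "enc_bool b = (if b then 1 else 0)"
instance by standard (auto simp: enc_bool_def)
end

instantiation int :: coded
begin
definition enc_int :: "int \<Rightarrow> nat" where "enc_int = int_encode"
instance by standard (simp add: enc_int_def int_encode_eq)
end

instantiation prod :: (coded, coded) coded
begin
definition enc_prod :: "'a \<times> 'b \<Rightarrow> nat" where
  "enc_prod z = prod_encode (enc (fst z), enc (snd z))"
instance by standard (auto simp: enc_prod_def enc_inject prod_eq_iff)
end

instantiation list :: (coded) coded
begin
definition enc_list :: "'a list \<Rightarrow> nat" where "enc_list xs = list_encode (map enc xs)"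
instance
proof
  fix xs ys :: "'a list"
  have "inj (enc :: 'a \<Rightarrow> nat)" by (simp add: inj_def enc_inject)
  then show "enc xs = enc ys \<longleftrightarrow> xs = ys"
    by (simp add: enc_list_def list_encode_eq inj_map_eq_map)
qed
end

lemma enc_Pair: "enc (x, y) = prod_encode (enc x, enc y)"
  by (simp add: enc_prod_def)

lemma enc_Nil: "enc [] = 0"
  by (simp add: enc_list_def)

lemma enc_Cons: "enc (x # xs) = Suc (prod_encode (enc x, enc xs))"
  by (simp add: enc_list_def)

text \<open>
  All functions are unary; several arguments are passed as a tuple. A local function that mentions
  the context \<open>e\<close> is thereby turned into a function of a tuple whose first component is \<open>e\<close>.
  The closure rules have the form that lets \<open>intro\<close> decompose any term built from the operations
  covered.
\<close>

definition computable :: "nat set \<Rightarrow> ('a::coded \<Rightarrow> 'b::coded) \<Rightarrow> bool" where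
  "computable A f \<longleftrightarrow> (\<exists>r. \<forall>x. run A r [enc x] = Some (enc (f x)))"

named_theorems computable_intros

lemma computableI: "(\<And>x. run A r [enc x] = Some (enc (f x))) \<Longrightarrow> computable A f"
  by (auto simp: computable_def)

text \<open>
  Computability depends on the effect on codes only. This is how a function between
  different types is replaced by one between numbers, and how the inverse of an encoding is seen to
  be computable: on codes it is the identity.
\<close>

lemma computable_recode:
  fixes f :: "'a::coded \<Rightarrow> 'b::coded" and g :: "'c::coded \<Rightarrow> 'd::coded"
  assumes "computable A g" "\<And>x. \<exists>y. enc y = enc x \<and> enc (g y) = enc (f x)"
  shows "computable A f"
  using assms unfolding computable_def by metis

lemma computable_id [computable_intros]: "computable A (\<lambda>x. x)"
  by (rule computableI[where r = "Proj 0"]) simp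

lemma computable_compose:
  assumes "computable A f" "computable A g"
  shows "computable A (\<lambda>x. f (g x))"
proof -
  from assms obtain r s where "\<And>x. run A r [enc x] = Some (enc (f x))"
    "\<And>x. run A s [enc x] = Some (enc (g x))"
    unfolding computable_def by blast
  then show ?thesis by (intro computableI[where r = "Comp r [s]"]) simp
qed

lemma computable_enc [computable_intros]:
  "computable A f \<Longrightarrow> computable A (\<lambda>x. enc (f x))"
  by (erule computable_recode) auto

lemma computable_const [computable_intros]: "computable A (\<lambda>_. c)"
proof -
  have "\<exists>r. \<forall>xs. run A r xs = Some k" for k
  proof (induction k)
    case 0
    have "\<forall>xs. run A Zero xs = Some 0" by simp
    then show ?case by blast
  next
    case (Suc k)
    then obtain r where "\<forall>xs. run A r xs = Some k" by blast
    then have "\<forall>xs. run A (Comp Succ [r]) xs = Some (Suc k)" by simp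
    then show ?case by blast
  qed
  then show ?thesis unfolding computable_def by blast
qed

lemma computable_Suc [computable_intros]:
  "computable A f \<Longrightarrow> computable A (\<lambda>x. Suc (f x))"
  by (rule computable_compose[where f = Suc], rule computableI[where r = Succ]) simp

definition add_prog :: recf where
  "add_prog = PrimRec (Proj 0) (Comp Succ [Proj 1])"

lemma run_add_prog: "run A add_prog [m, n] = Some (m + n)"
  by (induction m) (simp_all add: add_prog_def)

definition pred_prog :: recf where
  "pred_prog = PrimRec Zero (Proj 0)"

lemma run_pred_prog: "run A pred_prog [n] = Some (n - 1)"
  by (induction n) (simp_all add: pred_prog_def)

definition monus_prog :: recf where
  "monus_prog = PrimRec (Proj 0) (Comp pred_prog [Proj 1])"

lemma run_monus_prog: "run A monus_prog [m, n] = Some (n - m)"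
  by (induction m) (simp_all add: monus_prog_def run_pred_prog)

definition triangle_prog :: recf where
  "triangle_prog = PrimRec Zero (Comp add_prog [Comp Succ [Proj 0], Proj 1])"

lemma run_triangle_prog: "run A triangle_prog [n] = Some (triangle n)"
  by (induction n) (simp_all add: triangle_prog_def run_add_prog)

definition pair_prog :: recf where
  "pair_prog = Comp add_prog [Comp triangle_prog [add_prog], Proj 0]"

lemma run_pair_prog: "run A pair_prog [m, n] = Some (prod_encode (m, n))"
  by (simp add: pair_prog_def run_add_prog run_triangle_prog prod_encode_def)

text \<open>
  The pair \<open>(m, n)\<close> has code \<open>triangle (m + n) + m\<close>, which lies between the consecutive triangular
  numbers at \<open>m + n\<close> and \<open>m + n + 1\<close>. Unbounded search recovers \<open>m + n\<close>, and subtraction then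
  recovers both components.
\<close>

definition root_prog :: recf where
  "root_prog = Mu (Comp monus_prog [Comp triangle_prog [Comp Succ [Proj 0]], Comp Succ [Proj 1]])"

lemma triangle_mono: "m \<le> n \<Longrightarrow> triangle m \<le> triangle n"
  by (induction n rule: dec_induct) simp_all

lemma run_root_prog: "run A root_prog [prod_encode (m, n)] = Some (m + n)"
proof -
  let ?x = "prod_encode (m, n)"
  have x: "?x = triangle (m + n) + m" by (simp add: prod_encode_def)
  have iff: "?x < triangle (Suc k) \<longleftrightarrow> m + n \<le> k" for k
  proof
    show "?x < triangle (Suc k) \<Longrightarrow> m + n \<le> k"
      using triangle_mono[of "Suc k" "m + n"] unfolding x by linarith
    show "m + n \<le> k \<Longrightarrow> ?x < triangle (Suc k)"
      using triangle_mono[of "Suc (m + n)" "Suc k"] by (simp add: x)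
  qed
  have step: "run A (Comp monus_prog [Comp triangle_prog [Comp Succ [Proj 0]], Comp Succ [Proj 1]])
      [k, ?x] = Some (Suc ?x - triangle (Suc k))" for k
    by (simp add: run_monus_prog run_triangle_prog)
  have zero: "Suc ?x - triangle (Suc k) = 0 \<longleftrightarrow> m + n \<le> k" for k
    using iff[of k] by linarith
  have "(LEAST k. m + n \<le> k) = m + n" by (rule Least_equality) auto
  then show ?thesis
    unfolding root_prog_def run.simps(7) step option.inject zero by auto
qed

definition fst_prog :: recf where
  "fst_prog = Comp monus_prog [Comp triangle_prog [root_prog], Proj 0]"

definition snd_prog :: recf where
  "snd_prog = Comp monus_prog [fst_prog, root_prog]"

lemma run_fst_prog: "run A fst_prog [prod_encode (m, n)] = Some m"
  by (simp add: fst_prog_def run_root_prog run_monus_prog run_triangle_prog)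
     (simp add: prod_encode_def)

lemma run_snd_prog: "run A snd_prog [prod_encode (m, n)] = Some n"
  by (simp add: snd_prog_def run_root_prog run_monus_prog run_fst_prog)

lemma computable_Pair [computable_intros]:
  assumes "computable A f" "computable A g"
  shows "computable A (\<lambda>x. (f x, g x))"
proof -
  from assms obtain r s where "\<And>x. run A r [enc x] = Some (enc (f x))"
    "\<And>x. run A s [enc x] = Some (enc (g x))"
    unfolding computable_def by blast
  then show ?thesis
    by (intro computableI[where r = "Comp pair_prog [r, s]"]) (simp add: run_pair_prog enc_Pair)
qed

lemma computable_fst [computable_intros]:
  "computable A f \<Longrightarrow> computable A (\<lambda>x. fst (f x))"
  by (rule computable_compose[where f = fst], rule computableI[where r = fst_prog])
     (simp_all add: enc_prod_def run_fst_prog)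

lemma computable_snd [computable_intros]:
  "computable A f \<Longrightarrow> computable A (\<lambda>x. snd (f x))"
  by (rule computable_compose[where f = snd], rule computableI[where r = snd_prog])
     (simp_all add: enc_prod_def run_snd_prog)

text \<open>
  The context \<open>e\<close> is the parameter of the primitive recursion; the step program packs it with the
  counter and the previous value.
\<close>

lemma computable_rec_nat [computable_intros]:
  fixes f :: "'e::coded \<Rightarrow> 'a::coded"
  assumes "computable A f" "computable A n"
    and "computable A (\<lambda>z. g (fst z) (fst (snd z)) (snd (snd z)))"
  shows "computable A (\<lambda>e. rec_nat (f e) (g e) (n e))"
proof -
  from assms obtain F N G where F: "\<And>x. run A F [enc x] = Some (enc (f x))"
    and N: "\<And>x. run A N [enc x] = Some (enc (n x))"
    and G: "\<And>z. run A G [enc z] = Some (enc (g (fst z) (fst (snd z)) (snd (snd z))))"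
    unfolding computable_def by blast
  have G': "run A G [prod_encode (enc e, prod_encode (k, enc a))] = Some (enc (g e k a))" for e k a
    using G[of "(e, k, a)"] by (simp add: enc_Pair)
  let ?G = "Comp G [Comp pair_prog [Proj 2, Comp pair_prog [Proj 0, Proj 1]]]"
  have rec: "rec_nat (run A F [enc e]) (\<lambda>k r. Option.bind r (\<lambda>y. run A ?G (k # y # [enc e]))) m
      = Some (enc (rec_nat (f e) (g e) m))" for e m
    by (induction m) (simp_all add: F G' run_pair_prog)
  show ?thesis
    by (rule computableI[where r = "Comp (PrimRec F ?G) [N, Proj 0]"])
       (simp add: N rec del: run.simps(5), simp add: N rec[simplified])
qed

lemma computable_If [computable_intros]:
  assumes "computable A b" "computable A f" "computable A g"
  shows "computable A (\<lambda>e. if b e then f e else g e)"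
proof -
  have "computable A (\<lambda>e. rec_nat (g e) (\<lambda>_ _. f e) (enc (b e)))"
    by (intro computable_rec_nat assms computable_compose[OF assms(2)] computable_intros)
  moreover have "(\<lambda>e. rec_nat (g e) (\<lambda>_ _. f e) (enc (b e))) = (\<lambda>e. if b e then f e else g e)"
    by (auto simp: enc_bool_def)
  ultimately show ?thesis by simp
qed

lemma computable_pred [computable_intros]:
  fixes f :: "'e::coded \<Rightarrow> nat"
  shows "computable A f \<Longrightarrow> computable A (\<lambda>x. f x - Suc 0)"
  by (rule computable_compose[where f = "\<lambda>n. n - Suc 0"], rule computableI[where r = pred_prog])
     (simp_all add: run_pred_prog)

text \<open>
  The branch on a non-empty list runs only if the code of the list is a successor. This matters
  because predecessor and projections need not yield codes of type \<open>'a\<close> otherwise, and the program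
  for \<open>g\<close> may diverge on them. The list is therefore passed twice: as the number of recursion steps,
  which decides whether the step is executed at all, and as the parameter from which head and tail
  are read. All steps of the recursion compute the same value.
\<close>

lemma computable_case_list [computable_intros]:
  fixes xs :: "'e::coded \<Rightarrow> 'a::coded list" and f :: "'e \<Rightarrow> 'b::coded"
  assumes "computable A xs" "computable A f"
    and "computable A (\<lambda>z. g (fst z) (fst (snd z)) (snd (snd z)))"
  shows "computable A (\<lambda>e. case xs e of [] \<Rightarrow> f e | y # ys \<Rightarrow> g e y ys)"
proof -
  from assms obtain X F G where X: "\<And>x. run A X [enc x] = Some (enc (xs x))"
    and F: "\<And>x. run A F [enc x] = Some (enc (f x))"
    and G: "\<And>z. run A G [enc z] = Some (enc (g (fst z) (fst (snd z)) (snd (snd z))))"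
    unfolding computable_def by blast
  have G': "run A G [prod_encode (enc e, prod_encode (enc y, enc ys))] = Some (enc (g e y ys))"
    for e y ys
    using G[of "(e, y, ys)"] by (simp add: enc_Pair)
  (* The step program sees counter, previous value, context and list code, in this order. *)
  let ?G = "Comp G [Comp pair_prog [Proj 2, Comp pred_prog [Proj 3]]]"
  have step: "run A ?G [k, a, enc e, Suc (prod_encode (enc y, enc ys))] = Some (enc (g e y ys))"
    for k a e y ys
    using G'[of e y ys] by (simp add: run_pair_prog run_pred_prog)
  have rec: "rec_nat (Some u) (\<lambda>k r. Option.bind r
      (\<lambda>a. run A ?G (k # a # [enc e, Suc (prod_encode (enc y, enc ys))]))) (Suc m)
      = Some (enc (g e y ys))" for u e y ys m
    by (induction m) (simp_all add: step del: run.simps(5))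
  have F': "run A (Comp F [Proj 0]) [enc e, k] = Some (enc (f e))" for e k
    by (simp add: F)
  show ?thesis
  proof (rule computableI[where r = "Comp (PrimRec (Comp F [Proj 0]) ?G) [X, Proj 0, X]"])
    fix e
    have "run A (Comp (PrimRec (Comp F [Proj 0]) ?G) [X, Proj 0, X]) [enc e] =
        run A (PrimRec (Comp F [Proj 0]) ?G) [enc (xs e), enc e, enc (xs e)]"
      by (subst run.simps(5)) (simp add: X del: run.simps(5,6))
    also have "\<dots> = Some (enc (case xs e of [] \<Rightarrow> f e | y # ys \<Rightarrow> g e y ys))"
    proof (cases "xs e")
      case Nil
      then show ?thesis
        unfolding run.simps(6) by (simp add: enc_Nil F' del: run.simps(5))
    next
      case (Cons y ys)
      show ?thesis
        unfolding run.simps(6) Cons enc_Cons list.case F' rec by simp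
    qed
    finally show "run A (Comp (PrimRec (Comp F [Proj 0]) ?G) [X, Proj 0, X]) [enc e] = \<dots>" .
  qed
qed

lemma computable_Cons [computable_intros]:
  assumes "computable A f" "computable A g"
  shows "computable A (\<lambda>x. f x # g x)"
proof -
  have "computable A (\<lambda>x. Suc (enc (f x, g x)))"
    using computable_Pair[OF assms]
    by (intro computable_Suc) (erule computable_recode, auto)
  then show ?thesis
    by (rule computable_recode) (auto simp: enc_Cons enc_Pair)
qed

lemma length_le_enc: "length xs \<le> enc xs"
proof (induction xs)
  case (Cons x xs)
  have "enc xs \<le> prod_encode (enc x, enc xs)" by (rule le_prod_encode_2)
  with Cons show ?case by (simp add: enc_Cons)
qed simp

text \<open>
  The fold is iterated on the pair of the accumulator and the remaining list. The pair is stationary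
  once the list is exhausted, so that any number of steps above the length will do. The code of the
  list is such a number.
\<close>

lemma computable_foldl [computable_intros]:
  fixes xs :: "'e::coded \<Rightarrow> 'b::coded list" and f :: "'e \<Rightarrow> 'a::coded"
  assumes f: "computable A f" and xs: "computable A xs"
    and g: "computable A (\<lambda>z. g (fst z) (fst (snd z)) (snd (snd z)))"
  shows "computable A (\<lambda>e. foldl (g e) (f e) (xs e))"
proof -
  define step where "step = (\<lambda>e (k::nat) s. case snd s of [] \<Rightarrow> s | y # ys \<Rightarrow> (g e (fst s) y, ys))"
  have iter: "rec_nat (a, ys) (step e) n = (foldl (g e) a (take n ys), drop n ys)" for e a ys n
  proof (induction n)
    case (Suc n)
    show ?case
    proof (cases "drop n ys")
      case Nil
      then show ?thesis using Suc by (simp add: step_def)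
    next
      case (Cons z zs)
      then have n: "n < length ys" by (metis drop_all list.distinct(1) not_less)
      with Cons have "z = ys ! n" "zs = drop (Suc n) ys"
        by (metis Cons_nth_drop_Suc list.inject)+
      with n Cons show ?thesis using Suc by (simp add: step_def take_Suc_conv_app_nth)
    qed
  qed simp
  have g': "computable A (\<lambda>x. g (p x) (q x) (r x))"
    if "computable A p" "computable A q" "computable A r" for p :: "'x::coded \<Rightarrow> 'e" and q r
    using computable_compose[OF g computable_Pair[OF that(1) computable_Pair[OF that(2,3)]]] by simp
  have "computable A (\<lambda>e. fst (rec_nat (f e, xs e) (step e) (enc (xs e))))"
    unfolding step_def by (intro computable_intros g' f xs)
  then show ?thesis by (simp add: iter length_le_enc)
qed

lemma computable_binary:
  fixes g :: "'e::coded \<Rightarrow> 'b::coded \<Rightarrow> 'c::coded"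
  assumes "computable A (\<lambda>z. g (fst z) (snd z))" "computable A f" "computable A h"
  shows "computable A (\<lambda>x. g (f x) (h x))"
  using computable_compose[OF assms(1) computable_Pair[OF assms(2,3)]] by simp

section \<open>Arithmetic\<close>

lemma computable_plus_nat [computable_intros]:
  fixes f g :: "'e::coded \<Rightarrow> nat"
  assumes "computable A f" "computable A g"
  shows "computable A (\<lambda>x. f x + g x)"
proof -
  have "rec_nat n (\<lambda>_ r. Suc r) m = m + n" for m n by (induction m) simp_all
  moreover have "computable A (\<lambda>x. rec_nat (g x) (\<lambda>_ r. Suc r) (f x))"
    by (intro computable_intros assms)
  ultimately show ?thesis by simp
qed

lemma computable_minus_nat [computable_intros]:
  fixes f g :: "'e::coded \<Rightarrow> nat"
  assumes "computable A f" "computable A g"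
  shows "computable A (\<lambda>x. f x - g x)"
proof -
  have "rec_nat m (\<lambda>_ r. r - Suc 0) n = m - n" for m n by (induction n) simp_all
  moreover have "computable A (\<lambda>x. rec_nat (f x) (\<lambda>_ r. r - Suc 0) (g x))"
    by (intro computable_intros assms)
  ultimately show ?thesis by simp
qed

lemma computable_times_nat [computable_intros]:
  fixes f g :: "'e::coded \<Rightarrow> nat"
  assumes "computable A f" "computable A g"
  shows "computable A (\<lambda>x. f x * g x)"
proof -
  have "rec_nat 0 (\<lambda>_ r. n + r) m = m * n" for m n :: nat by (induction m) simp_all
  moreover have "computable A (\<lambda>x. rec_nat 0 (\<lambda>_ r. g x + r) (f x))"
    by (intro computable_intros computable_compose[OF assms(2)] assms(1))
  ultimately show ?thesis by simp
qed

lemma computable_power_nat [computable_intros]: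
  fixes f g :: "'e::coded \<Rightarrow> nat"
  assumes "computable A f" "computable A g"
  shows "computable A (\<lambda>x. f x ^ g x)"
proof -
  have "rec_nat 1 (\<lambda>_ r. m * r) n = m ^ n" for m n :: nat by (induction n) simp_all
  moreover have "computable A (\<lambda>x. rec_nat 1 (\<lambda>_ r. f x * r) (g x))"
    by (intro computable_intros computable_compose[OF assms(1)] assms(2))
  ultimately show ?thesis by simp
qed

lemma computable_Not [computable_intros]:
  assumes "computable A f"
  shows "computable A (\<lambda>x. \<not> f x)"
proof -
  have "computable A (\<lambda>x. if f x then False else True)" by (intro computable_intros assms)
  moreover have "(\<lambda>x. if f x then False else True) = (\<lambda>x. \<not> f x)" by auto
  ultimately show ?thesis by (simp only:)
qed

lemma computable_conj [computable_intros]: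
  assumes "computable A f" "computable A g"
  shows "computable A (\<lambda>x. f x \<and> g x)"
proof -
  have "computable A (\<lambda>x. if f x then g x else False)" by (intro computable_intros assms)
  moreover have "(\<lambda>x. if f x then g x else False) = (\<lambda>x. f x \<and> g x)" by auto
  ultimately show ?thesis by (simp only:)
qed

lemma computable_le_nat [computable_intros]:
  fixes f g :: "'e::coded \<Rightarrow> nat"
  assumes "computable A f" "computable A g"
  shows "computable A (\<lambda>x. f x \<le> g x)"
proof -
  have "rec_nat True (\<lambda>_ _. False) n \<longleftrightarrow> n = 0" for n :: nat by (cases n) simp_all
  moreover have "computable A (\<lambda>x. rec_nat True (\<lambda>_ _. False) (f x - g x))"
    by (intro computable_intros assms)
  ultimately show ?thesis by simp
qed

lemma computable_eq [computable_intros]: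
  fixes f g :: "'e::coded \<Rightarrow> 'a::coded"
  assumes "computable A f" "computable A g"
  shows "computable A (\<lambda>x. f x = g x)"
proof -
  have "computable A (\<lambda>x. enc (f x) \<le> enc (g x) \<and> enc (g x) \<le> enc (f x))"
    by (intro computable_intros assms)
  moreover have "(enc a \<le> enc b \<and> enc b \<le> enc a) = (a = b)" for a b :: 'a
    using enc_inject[of a b] by auto
  ultimately show ?thesis by simp
qed

lemma computable_even [computable_intros]:
  fixes f :: "'e::coded \<Rightarrow> nat"
  assumes "computable A f"
  shows "computable A (\<lambda>x. even (f x))"
proof -
  have "rec_nat True (\<lambda>_ b. \<not> b) n = even n" for n by (induction n) simp_all
  moreover have "computable A (\<lambda>x. rec_nat True (\<lambda>_ b. \<not> b) (f x))"
    by (intro computable_intros assms)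
  ultimately show ?thesis by simp
qed

lemma computable_div_2 [computable_intros]:
  fixes f :: "'e::coded \<Rightarrow> nat"
  assumes "computable A f"
  shows "computable A (\<lambda>x. f x div 2)"
proof -
  have "rec_nat 0 (\<lambda>k h. if odd k then Suc h else h) n = n div 2" for n
    by (induction n) simp_all
  moreover have "computable A (\<lambda>x. rec_nat 0 (\<lambda>k h. if odd k then Suc h else h) (f x))"
    by (intro computable_intros assms)
  ultimately show ?thesis by simp
qed

lemma computable_div_power_2 [computable_intros]:
  fixes f g :: "'e::coded \<Rightarrow> nat"
  assumes "computable A f" "computable A g"
  shows "computable A (\<lambda>x. f x div 2 ^ g x)"
proof -
  have "rec_nat m (\<lambda>_ h. h div 2) n = m div 2 ^ n" for m n :: nat
    by (induction n) (simp_all add: div_mult2_eq[symmetric] mult.commute)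
  moreover have "computable A (\<lambda>x. rec_nat (f x) (\<lambda>_ h. h div 2) (g x))"
    by (intro computable_intros assms)
  ultimately show ?thesis by simp
qed

text \<open>
  Integer arithmetic is reduced to arithmetic of natural numbers through the positive and the
  negative part.
\<close>

lemma enc_int_eq: "enc i = (if 0 \<le> i then 2 * nat i else Suc (2 * nat (- i - 1)))"
  by (simp add: enc_int_def int_encode_def sum_encode_def)

lemma computable_nat [computable_intros]:
  assumes "computable A f"
  shows "computable A (\<lambda>x. nat (f x))"
proof -
  have "computable A (\<lambda>x. if odd (enc (f x)) then 0 else enc (f x) div 2)"
    by (intro computable_intros assms)
  moreover have "(if odd (enc i) then 0 else enc i div 2) = nat i" for i :: int
    by (simp add: enc_int_eq)
  ultimately show ?thesis by simp
qed

lemma computable_int_diff: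
  assumes "computable A f" "computable A g"
  shows "computable A (\<lambda>x. int (f x) - int (g x))"
proof -
  have "computable A (\<lambda>x. if g x \<le> f x then 2 * (f x - g x) else Suc (2 * (g x - f x - Suc 0)))"
    by (intro computable_intros assms)
  then show ?thesis
    by (rule computable_recode) (auto simp: enc_int_eq)
qed

lemma computable_uminus_int [computable_intros]:
  fixes f :: "'e::coded \<Rightarrow> int"
  assumes "computable A f"
  shows "computable A (\<lambda>x. - f x)"
proof -
  have "computable A (\<lambda>x. if odd (enc (f x)) then Suc (enc (f x)) div 2 else 0)"
    by (intro computable_intros assms)
  moreover have "(if odd (enc i) then Suc (enc i) div 2 else 0) = nat (- i)" for i :: int
    by (auto simp: enc_int_eq)
  ultimately have "computable A (\<lambda>x. nat (- f x))" by simp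
  note computable_int_diff[OF this computable_nat[OF assms]]
  moreover have "int (nat (- i)) - int (nat i) = - i" for i by simp
  ultimately show ?thesis by simp
qed

lemma computable_plus_int [computable_intros]:
  fixes f g :: "'e::coded \<Rightarrow> int"
  assumes "computable A f" "computable A g"
  shows "computable A (\<lambda>x. f x + g x)"
proof -
  have "computable A (\<lambda>x. int (nat (f x) + nat (g x)) - int (nat (- f x) + nat (- g x)))"
    by (intro computable_int_diff computable_intros assms)
  moreover have "int (nat i + nat j) - int (nat (- i) + nat (- j)) = i + j" for i j by simp
  ultimately show ?thesis by simp
qed

lemma computable_times_int [computable_intros]:
  fixes f g :: "'e::coded \<Rightarrow> int"
  assumes "computable A f" "computable A g"
  shows "computable A (\<lambda>x. f x * g x)"
proof -
  have "computable A (\<lambda>x. int (nat (f x) * nat (g x) + nat (- f x) * nat (- g x))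
      - int (nat (f x) * nat (- g x) + nat (- f x) * nat (g x)))"
    by (intro computable_int_diff computable_intros assms)
  moreover have "int (nat i * nat j + nat (- i) * nat (- j))
      - int (nat i * nat (- j) + nat (- i) * nat j) = i * j" for i j
    by (cases "0 \<le> i"; cases "0 \<le> j") simp_all
  ultimately show ?thesis by simp
qed

section \<open>Lists and finite sets\<close>

lemma computable_rev [computable_intros]:
  fixes f :: "'e::coded \<Rightarrow> 'a::coded list"
  assumes "computable A f"
  shows "computable A (\<lambda>x. rev (f x))"
proof -
  have "foldl (\<lambda>a y. y # a) zs ys = rev ys @ zs" for ys zs :: "'a list"
    by (induction ys arbitrary: zs) simp_all
  moreover have "computable A (\<lambda>x. foldl (\<lambda>a y. y # a) [] (f x))"
    by (intro computable_intros assms)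
  ultimately show ?thesis by simp
qed

lemma computable_append [computable_intros]:
  fixes f g :: "'e::coded \<Rightarrow> 'a::coded list"
  assumes "computable A f" "computable A g"
  shows "computable A (\<lambda>x. f x @ g x)"
proof -
  have "foldl (\<lambda>a y. y # a) zs ys = rev ys @ zs" for ys zs :: "'a list"
    by (induction ys arbitrary: zs) simp_all
  moreover have "computable A (\<lambda>x. foldl (\<lambda>a y. y # a) (g x) (rev (f x)))"
    by (intro computable_intros assms)
  ultimately show ?thesis by simp
qed

lemma computable_map [computable_intros]:
  fixes g :: "'e::coded \<Rightarrow> 'a::coded \<Rightarrow> 'b::coded"
  assumes "computable A xs" "computable A (\<lambda>z. g (fst z) (snd z))"
  shows "computable A (\<lambda>e. map (g e) (xs e))"
proof -
  have "foldl (\<lambda>a y. a @ [h y]) zs ys = zs @ map h ys" for h :: "'a \<Rightarrow> 'b" and ys zs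
    by (induction ys arbitrary: zs) simp_all
  moreover have "computable A (\<lambda>x. foldl (\<lambda>a y. a @ [g x y]) [] (xs x))"
    by (intro computable_intros computable_binary[OF assms(2)] assms(1))
  ultimately show ?thesis by simp
qed

lemma computable_concat [computable_intros]:
  fixes f :: "'e::coded \<Rightarrow> 'a::coded list list"
  assumes "computable A f"
  shows "computable A (\<lambda>x. concat (f x))"
proof -
  have "foldl (@) zs ys = zs @ concat ys" for ys and zs :: "'a list"
    by (induction ys arbitrary: zs) simp_all
  moreover have "computable A (\<lambda>x. foldl (\<lambda>a y. a @ y) [] (f x))"
    by (intro computable_intros assms)
  ultimately show ?thesis by simp
qed

lemma computable_filter [computable_intros]:
  fixes g :: "'e::coded \<Rightarrow> 'a::coded \<Rightarrow> bool"
  assumes "computable A xs" "computable A (\<lambda>z. g (fst z) (snd z))"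
  shows "computable A (\<lambda>e. filter (g e) (xs e))"
proof -
  have "concat (map (\<lambda>y. if h y then [y] else []) ys) = filter h ys" for h :: "'a \<Rightarrow> bool" and ys
    by (induction ys) simp_all
  moreover have "computable A (\<lambda>e. concat (map (\<lambda>y. if g e y then [y] else []) (xs e)))"
    by (intro computable_intros computable_binary[OF assms(2)] assms(1))
  ultimately show ?thesis by simp
qed

lemma computable_upt [computable_intros]:
  assumes "computable A f"
  shows "computable A (\<lambda>x. [0..<f x])"
proof -
  have "rec_nat [] (\<lambda>k r. r @ [k]) n = [0..<n]" for n by (induction n) simp_all
  moreover have "computable A (\<lambda>x. rec_nat [] (\<lambda>k r. r @ [k]) (f x))"
    by (intro computable_intros assms)
  ultimately show ?thesis by simp
qed

lemma computable_replicate [computable_intros]: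
  assumes "computable A n" "computable A f"
  shows "computable A (\<lambda>x. replicate (n x) (f x))"
proof -
  have "computable A (\<lambda>x. map (\<lambda>_. f x) [0..<n x])"
    by (intro computable_intros computable_compose[OF assms(2)] assms(1))
  then show ?thesis by (simp add: map_replicate_const)
qed

lemma computable_sum_list [computable_intros]:
  fixes xs :: "'e::coded \<Rightarrow> int list"
  assumes "computable A xs"
  shows "computable A (\<lambda>x. sum_list (xs x))"
proof -
  have "foldl (+) i ys = i + sum_list ys" for i :: int and ys
    by (induction ys arbitrary: i) simp_all
  moreover have "computable A (\<lambda>x. foldl (\<lambda>a y. a + y) 0 (xs x))"
    by (intro computable_intros assms)
  ultimately show ?thesis by simp
qed

lemma computable_nth_default [computable_intros]:
  fixes d :: "'a::coded"
  assumes "computable A xs" "computable A n"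
  shows "computable A (\<lambda>x. nth_default d (xs x) (n x))"
proof -
  let ?tl = "\<lambda>ys. case ys of [] \<Rightarrow> [] | z # zs \<Rightarrow> zs"
  have "rec_nat ys (\<lambda>_. ?tl) k = drop k ys" for ys :: "'a list" and k
    by (induction k) (auto simp: drop_Suc tl_drop split: list.split, (metis list.sel tl_drop)+)
  moreover have "(case drop k ys of [] \<Rightarrow> d | z # zs \<Rightarrow> z) = nth_default d ys k" for ys k
    by (auto simp: nth_default_def drop_eq_Nil split: list.split)
       (metis Cons_nth_drop_Suc list.inject)
  moreover have "computable A
      (\<lambda>x. case rec_nat (xs x) (\<lambda>_. ?tl) (n x) of [] \<Rightarrow> d | z # zs \<Rightarrow> z)"
    by (intro computable_intros assms)
  ultimately show ?thesis by simp
qed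

text \<open>
  Elements may repeat in the list, so \<open>2 ^ y\<close> is added only if bit \<open>y\<close> is not yet set.
\<close>

lemma computable_set_encode [computable_intros]:
  assumes "computable A xs"
  shows "computable A (\<lambda>x. set_encode (set (xs x)))"
proof -
  have "foldl (\<lambda>s y. if odd (s div 2 ^ y) then s else s + 2 ^ y) (set_encode S) ys =
      set_encode (S \<union> set ys)" if "finite S" for S ys
    using that
  proof (induction ys arbitrary: S)
    case (Cons y ys)
    have "odd (set_encode S div 2 ^ y) \<longleftrightarrow> y \<in> S"
      using set_encode_inverse[OF Cons.prems] by (auto simp: set_decode_def)
    then have "(if odd (set_encode S div 2 ^ y) then set_encode S else set_encode S + 2 ^ y) =
        set_encode (insert y S)"
      using Cons.prems by (simp add: insert_absorb)
    with Cons show ?case by simp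
  qed simp
  from this[of "{}"] have "foldl (\<lambda>s y. if odd (s div 2 ^ y) then s else s + 2 ^ y) (0::nat) ys =
      set_encode (set ys)" for ys by simp
  moreover have "computable A
      (\<lambda>x. foldl (\<lambda>s y. if odd (s div 2 ^ y) then s else s + 2 ^ y) (0::nat) (xs x))"
    by (intro computable_intros assms)
  ultimately show ?thesis by simp
qed

text \<open>
  An explicit list of the elements of \<open>set_decode s\<close>; they are below \<open>s\<close> since \<open>n < 2 ^ n\<close>.
\<close>

definition set_decode_list :: "nat \<Rightarrow> nat list" where
  "set_decode_list s = filter (\<lambda>n. odd (s div 2 ^ n)) [0..<s]"

lemma set_set_decode_list: "set (set_decode_list s) = set_decode s"
  by (auto simp: set_decode_list_def set_decode_def)
    (metis div_less even_zero less_exp linorder_le_less_linear order_less_le_trans)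

lemma distinct_set_decode_list: "distinct (set_decode_list s)"
  by (simp add: set_decode_list_def)

lemma computable_set_decode_list [computable_intros]:
  "computable A f \<Longrightarrow> computable A (\<lambda>x. set_decode_list (f x))"
  unfolding set_decode_list_def
  by (intro computable_intros | erule computable_compose)+

section \<open>Polynomials as lists of terms\<close>

text \<open>
  A term is a list of exponents with a coefficient. Neither are equal monomials merged nor zero
  coefficients removed, which keeps the ring operations simple enough to be visibly computable.
  Missing exponents count as zero, and exponents from position \<open>q\<close> on are ignored when the list is
  read as a polynomial in \<open>q\<close> variables.
\<close>

type_synonym term_list = "(nat list \<times> int) list"

definition teval :: "nat \<Rightarrow> term_list \<Rightarrow> (nat \<Rightarrow> int) \<Rightarrow> int" where
  "teval q L x = (\<Sum>(m, c)\<leftarrow>L. c * (\<Prod>i<q. x i ^ nth_default 0 m i))"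

lemma teval_Nil [simp]: "teval q [] x = 0"
  by (simp add: teval_def)

lemma teval_Cons [simp]:
  "teval q ((m, c) # L) x = c * (\<Prod>i<q. x i ^ nth_default 0 m i) + teval q L x"
  by (simp add: teval_def)

lemma teval_append [simp]: "teval q (L @ M) x = teval q L x + teval q M x"
  by (simp add: teval_def)

lemma teval_concat: "teval q (concat Ls) x = (\<Sum>L\<leftarrow>Ls. teval q L x)"
  by (induction Ls) simp_all

lemma teval_cong: "(\<And>i. i < q \<Longrightarrow> x i = y i) \<Longrightarrow> teval q L x = teval q L y"
  by (simp add: teval_def cong: prod.cong_simp)

definition tminus :: "term_list \<Rightarrow> term_list \<Rightarrow> term_list" where
  "tminus L M = L @ map (\<lambda>t. (fst t, - snd t)) M"

lemma teval_tminus [simp]: "teval q (tminus L M) x = teval q L x - teval q M x"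
proof -
  have "teval q (map (\<lambda>t. (fst t, - snd t)) M) x = - teval q M x"
    by (induction M) auto
  then show ?thesis by (simp add: tminus_def)
qed

definition tmul :: "nat \<Rightarrow> term_list \<Rightarrow> term_list \<Rightarrow> term_list" where
  "tmul q L M = concat (map (\<lambda>s. map (\<lambda>t.
     (map (\<lambda>i. nth_default 0 (fst s) i + nth_default 0 (fst t) i) [0..<q], snd s * snd t)) M) L)"

lemma nth_default_map_upt: "i < q \<Longrightarrow> nth_default 0 (map f [0..<q]) i = f i"
  by (simp add: nth_default_def)

lemma teval_tmul [simp]: "teval q (tmul q L M) x = teval q L x * teval q M x"
proof -
  have "teval q (map (\<lambda>t. (map (\<lambda>i. nth_default 0 m i + nth_default 0 (fst t) i) [0..<q],
      c * snd t)) M) x = c * (\<Prod>i<q. x i ^ nth_default 0 m i) * teval q M x" for m c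
    by (induction M) (auto simp: nth_default_map_upt power_add prod.distrib algebra_simps
        cong: prod.cong_simp)
  then show ?thesis
    by (induction L) (auto simp: tmul_def algebra_simps)
qed

definition tprod :: "nat \<Rightarrow> term_list list \<Rightarrow> term_list" where
  "tprod q Ls = foldl (tmul q) [([], 1)] Ls"

lemma teval_tprod: "teval q (tprod q Ls) x = (\<Prod>L\<leftarrow>Ls. teval q L x)"
proof -
  have "teval q (foldl (tmul q) M Ls) x = teval q M x * (\<Prod>L\<leftarrow>Ls. teval q L x)" for M
    by (induction Ls arbitrary: M) (simp_all add: mult.assoc)
  then show ?thesis by (simp add: tprod_def)
qed

text \<open>
  The polynomial $a x_i + b$.
\<close>

definition tlinear :: "nat \<Rightarrow> int \<Rightarrow> int \<Rightarrow> term_list" where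
  "tlinear i a b = [(replicate i 0 @ [1], a), ([], b)]"

lemma teval_tlinear [simp]:
  assumes "i < q"
  shows "teval q (tlinear i a b) x = a * x i + b"
proof -
  have "(\<Prod>j<q. x j ^ nth_default 0 (replicate i 0 @ [1]) j) = (\<Prod>j<q. if j = i then x i else 1)"
    by (rule prod.cong) (auto simp: nth_default_append nth_default_Cons split: nat.split)
  then show ?thesis using assms by (simp add: tlinear_def)
qed

definition pad :: "nat \<Rightarrow> nat list \<Rightarrow> nat list" where
  "pad q m = map (nth_default 0 m) [0..<q]"

text \<open>
  Renames variable \<open>i\<close> to \<open>k + i\<close>. The exponents are first cut off at \<open>p\<close>, for otherwise exponents
  that do not belong to the \<open>p\<close> variables would become visible.
\<close>

definition tshift :: "nat \<Rightarrow> nat \<Rightarrow> term_list \<Rightarrow> term_list" where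
  "tshift p k L = map (\<lambda>t. (replicate k 0 @ pad p (fst t), snd t)) L"

lemma teval_tshift:
  assumes "k + p \<le> q"
  shows "teval q (tshift p k L) x = teval p L (\<lambda>i. x (k + i))"
proof -
  have "(\<Prod>i<q. x i ^ nth_default 0 (replicate k 0 @ pad p m) i) =
      (\<Prod>i\<in>{k..<k + p}. x i ^ nth_default 0 (replicate k 0 @ pad p m) i)" for m
    using assms
    by (intro prod.mono_neutral_right) (auto simp: nth_default_append pad_def nth_default_def nth_append)
  also have "\<dots> m = (\<Prod>i<p. x (k + i) ^ nth_default 0 m i)" for m
    by (rule prod.reindex_bij_witness[of _ "\<lambda>i. k + i" "\<lambda>i. i - k"])
       (auto simp: nth_default_append pad_def nth_default_map_upt)
  finally have block: "(\<Prod>i<q. x i ^ nth_default 0 (replicate k 0 @ pad p m) i) =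
      (\<Prod>i<p. x (k + i) ^ nth_default 0 m i)" for m .
  show ?thesis by (induction L) (auto simp: tshift_def block)
qed

section \<open>Term lists and codes of equations\<close>

definition monom_of :: "nat \<Rightarrow> nat list \<Rightarrow> nat \<Rightarrow>\<^sub>0 nat" where
  "monom_of q m = Poly_Mapping.nth (pad q m)"

definition mpoly_of :: "nat \<Rightarrow> term_list \<Rightarrow> int_mpoly" where
  "mpoly_of q L = (\<Sum>(m, c)\<leftarrow>L. Poly_Mapping.single (monom_of q m) c)"

lemma lookup_monom_of: "Poly_Mapping.lookup (monom_of q m) i = (if i < q then nth_default 0 m i else 0)"
  by (simp add: monom_of_def pad_def nth_default_def)

lemma keys_monom_of: "Poly_Mapping.keys (monom_of q m) \<subseteq> {..<q}"
  by (auto simp: in_keys_iff lookup_monom_of split: if_splits)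

lemma pad_eq_lookup: "map (Poly_Mapping.lookup (monom_of q m)) [0..<q] = pad q m"
  by (simp add: pad_def lookup_monom_of)

lemma monom_of_eq_iff: "monom_of q m = monom_of q n \<longleftrightarrow> pad q m = pad q n"
  by (metis pad_eq_lookup monom_of_def)

lemma monom_of_lookup:
  assumes "Poly_Mapping.keys m \<subseteq> {..<q}"
  shows "monom_of q (map (Poly_Mapping.lookup m) [0..<q]) = m"
  using assms by (intro poly_mapping_eqI) (auto simp: lookup_monom_of nth_default_map_upt in_keys_iff)

lemma mpoly_eval_superset:
  assumes "finite K" "Poly_Mapping.keys D \<subseteq> K"
  shows "mpoly_eval D x = (\<Sum>m\<in>K. Poly_Mapping.lookup D m *
    (\<Prod>i\<in>Poly_Mapping.keys m. x i ^ Poly_Mapping.lookup m i))"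
  unfolding mpoly_eval_def using assms
  by (intro sum.mono_neutral_left) (auto simp: in_keys_iff)

lemma mpoly_eval_zero [simp]: "mpoly_eval 0 x = 0"
  by (simp add: mpoly_eval_def)

lemma mpoly_eval_plus: "mpoly_eval (D + E) x = mpoly_eval D x + mpoly_eval E x"
  using Poly_Mapping.keys_add[of D E]
  by (simp add: mpoly_eval_superset[of "Poly_Mapping.keys D \<union> Poly_Mapping.keys E"]
      lookup_add algebra_simps sum.distrib)

lemma mpoly_eval_single:
  "mpoly_eval (Poly_Mapping.single m c) x =
    c * (\<Prod>i\<in>Poly_Mapping.keys m. x i ^ Poly_Mapping.lookup m i)"
  by (simp add: mpoly_eval_def)

lemma mpoly_eval_mpoly_of: "mpoly_eval (mpoly_of q L) x = teval q L x"
proof (induction L)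
  case (Cons t L)
  obtain m c where t: "t = (m, c)" by fastforce
  have "(\<Prod>i\<in>Poly_Mapping.keys (monom_of q m). x i ^ Poly_Mapping.lookup (monom_of q m) i) =
      (\<Prod>i<q. x i ^ Poly_Mapping.lookup (monom_of q m) i)"
    using keys_monom_of by (intro prod.mono_neutral_left) (auto simp: in_keys_iff)
  then show ?case
    using Cons by (simp add: t mpoly_of_def mpoly_eval_plus mpoly_eval_single lookup_monom_of)
qed (simp add: mpoly_of_def)

definition tcoeff :: "nat \<Rightarrow> term_list \<Rightarrow> nat list \<Rightarrow> int" where
  "tcoeff q L n = (\<Sum>t\<leftarrow>L. if pad q (fst t) = n then snd t else 0)"

text \<open>
  Terms of the list with the same padded exponents are merged by the passage to a polynomial.
\<close>

lemma lookup_mpoly_of: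
  "Poly_Mapping.lookup (mpoly_of q L) (monom_of q n) = tcoeff q L (pad q n)"
  by (induction L) (auto simp: mpoly_of_def tcoeff_def lookup_add lookup_single monom_of_eq_iff)

lemma keys_mpoly_of: "Poly_Mapping.keys (mpoly_of q L) \<subseteq> (\<lambda>t. monom_of q (fst t)) ` set L"
proof (induction L)
  case (Cons t L)
  obtain m c where t: "t = (m, c)" by fastforce
  have "mpoly_of q (t # L) = Poly_Mapping.single (monom_of q m) c + mpoly_of q L"
    by (simp add: mpoly_of_def t)
  then have "Poly_Mapping.keys (mpoly_of q (t # L)) \<subseteq>
      Poly_Mapping.keys (Poly_Mapping.single (monom_of q m) c) \<union> Poly_Mapping.keys (mpoly_of q L)"
    by (simp only: Poly_Mapping.keys_add)
  moreover have "Poly_Mapping.keys (Poly_Mapping.single (monom_of q m) c) \<subseteq> {monom_of q m}"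
    by simp
  ultimately show ?case using Cons by (auto simp: t)
qed (simp add: mpoly_of_def)

lemma mpoly_of_in_dioph_eqs: "1 \<le> q \<Longrightarrow> (q, mpoly_of q L) \<in> dioph_eqs"
  using keys_mpoly_of[of q L] keys_monom_of by (force simp: dioph_eqs_def)

lemma solvable_iff_teval_zero:
  "int_solutions (q, mpoly_of q L) \<noteq> {} \<longleftrightarrow> (\<exists>x. teval q L x = 0)"
proof
  assume "\<exists>x. teval q L x = 0"
  then obtain x where "teval q L x = 0" by blast
  moreover have "teval q L ((!) (map x [0..<q])) = teval q L x" by (rule teval_cong) simp
  ultimately have "map x [0..<q] \<in> int_solutions (q, mpoly_of q L)"
    by (simp add: int_solutions_def mpoly_eval_mpoly_of)
  then show "int_solutions (q, mpoly_of q L) \<noteq> {}" by blast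
qed (auto simp: int_solutions_def mpoly_eval_mpoly_of)

definition poly_code :: "nat \<Rightarrow> term_list \<Rightarrow> nat" where
  "poly_code q L = eq_code (q, mpoly_of q L)"

text \<open>
  The code of an equation is computed from any term list by merging terms. A monomial that occurs
  repeatedly in the list contributes the same pair each time, and these copies disappear in the set.
\<close>

lemma poly_code_eq:
  "poly_code q L = prod_encode (q, set_encode (set (map enc (filter (\<lambda>t. snd t \<noteq> 0)
     (map (\<lambda>t. (pad q (fst t), tcoeff q L (pad q (fst t)))) L)))))"
proof -
  let ?D = "mpoly_of q L"
  let ?F = "\<lambda>m. prod_encode (monom_code q m, int_encode (Poly_Mapping.lookup ?D m))"
  have F: "?F (monom_of q m) = enc (pad q m, tcoeff q L (pad q m))" for m
    by (simp add: enc_prod_def enc_list_def enc_int_def monom_code_def pad_eq_lookup lookup_mpoly_of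
        enc_nat_def[abs_def])
  have "Poly_Mapping.keys ?D = {k \<in> (\<lambda>t. monom_of q (fst t)) ` set L. Poly_Mapping.lookup ?D k \<noteq> 0}"
    using keys_mpoly_of[of q L] by (auto simp: in_keys_iff)
  also have "\<dots> = (\<lambda>t. monom_of q (fst t)) ` {t \<in> set L. tcoeff q L (pad q (fst t)) \<noteq> 0}"
    by (auto simp: lookup_mpoly_of)
  finally have "?F ` Poly_Mapping.keys ?D = (\<lambda>t. enc (pad q (fst t), tcoeff q L (pad q (fst t)))) `
      {t \<in> set L. tcoeff q L (pad q (fst t)) \<noteq> 0}"
    by (simp only: image_image F)
  also have "\<dots> = set (map enc (filter (\<lambda>t. snd t \<noteq> 0)
      (map (\<lambda>t. (pad q (fst t), tcoeff q L (pad q (fst t)))) L)))"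
    by (auto simp: image_iff)
  finally show ?thesis by (simp add: poly_code_def eq_code_def)
qed

definition term_decode :: "nat \<Rightarrow> nat list \<times> int" where
  "term_decode y = (list_decode (fst (prod_decode y)), int_decode (snd (prod_decode y)))"

lemma enc_nat_list: "enc m = list_encode m" for m :: "nat list"
  by (simp add: enc_list_def enc_nat_def[abs_def])

lemma enc_term_decode [simp]: "enc (term_decode y) = y"
  by (simp add: term_decode_def enc_prod_def enc_nat_list enc_int_def)

text \<open>
  On the code of an equation, these two functions return a term list and the number of variables.
  On other numbers their values have no meaning; \<open>valid_code\<close> below tells the cases apart.
\<close>

definition decode_terms :: "nat \<Rightarrow> term_list" where
  "decode_terms n = map term_decode (set_decode_list (snd (prod_decode n)))"

definition decode_arity :: "nat \<Rightarrow> nat" where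
  "decode_arity n = fst (prod_decode n)"

lemma decode_arity_eq_code [simp]: "decode_arity (eq_code (p, D)) = p"
  by (simp add: decode_arity_def eq_code_def)

lemma mpoly_of_decode_terms:
  assumes "(p, D) \<in> dioph_eqs"
  shows "mpoly_of p (decode_terms (eq_code (p, D))) = D"
proof -
  let ?F = "\<lambda>m. prod_encode (monom_code p m, int_encode (Poly_Mapping.lookup D m))"
  let ?S = "?F ` Poly_Mapping.keys D"
  have vars: "Poly_Mapping.keys m \<subseteq> {..<p}" if "m \<in> Poly_Mapping.keys D" for m
    using that assms by (auto simp: dioph_eqs_def)
  have inj: "inj_on ?F (Poly_Mapping.keys D)"
    using monom_code_inj[OF vars vars] by (auto intro!: inj_onI)
  have F: "term_decode (?F m) = (map (Poly_Mapping.lookup m) [0..<p], Poly_Mapping.lookup D m)" for m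
    by (simp add: term_decode_def monom_code_def)
  have S: "set (set_decode_list (snd (prod_decode (eq_code (p, D))))) = ?S"
    by (simp add: eq_code_def set_set_decode_list)
  have "mpoly_of p (decode_terms (eq_code (p, D))) =
      (\<Sum>y\<in>?S. case term_decode y of (m, c) \<Rightarrow> Poly_Mapping.single (monom_of p m) c)"
    unfolding mpoly_of_def decode_terms_def map_map
    by (subst sum_list_distinct_conv_sum_set) (simp_all add: distinct_set_decode_list S)
  also have "\<dots> = (\<Sum>m\<in>Poly_Mapping.keys D. Poly_Mapping.single
      (monom_of p (map (Poly_Mapping.lookup m) [0..<p])) (Poly_Mapping.lookup D m))"
    by (simp add: sum.reindex[OF inj] F)
  also have "\<dots> = (\<Sum>m\<in>Poly_Mapping.keys D. Poly_Mapping.single m (Poly_Mapping.lookup D m))"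
    by (rule sum.cong) (simp_all add: monom_of_lookup vars)
  also have "\<dots> = D"
    by (rule poly_mapping_eqI) (simp add: lookup_sum lookup_single when_def in_keys_iff)
  finally show ?thesis .
qed

text \<open>
  Codes are recognised by decoding and encoding again. The result of encoding is the code of an
  equation, and \<open>mpoly_of_decode_terms\<close> shows that codes are reproduced.
\<close>

definition valid_code :: "nat \<Rightarrow> bool" where
  "valid_code n \<longleftrightarrow> 1 \<le> decode_arity n \<and> poly_code (decode_arity n) (decode_terms n) = n"

lemma valid_code_iff: "valid_code n \<longleftrightarrow> n \<in> eq_code ` dioph_eqs"
proof
  assume "valid_code n"
  then show "n \<in> eq_code ` dioph_eqs"
    unfolding valid_code_def poly_code_def by (metis imageI mpoly_of_in_dioph_eqs)
next
  assume "n \<in> eq_code ` dioph_eqs"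
  then obtain p D where "(p, D) \<in> dioph_eqs" "n = eq_code (p, D)" by auto
  then show "valid_code n"
    by (auto simp: valid_code_def poly_code_def mpoly_of_decode_terms) (auto simp: dioph_eqs_def)
qed

lemma poly_code_in_solvable_codes_iff:
  assumes "1 \<le> q"
  shows "poly_code q L \<in> solvable_codes \<longleftrightarrow> (\<exists>x. teval q L x = 0)"
proof -
  have "poly_code q L \<in> solvable_codes \<longleftrightarrow> int_solutions (q, mpoly_of q L) \<noteq> {}"
    unfolding solvable_codes_def poly_code_def
    using mpoly_of_in_dioph_eqs[OF assms] by (auto dest: inj_onD[OF inj_on_eq_code])
  then show ?thesis by (simp add: solvable_iff_teval_zero)
qed

section \<open>Many solutions as one equation\<close>

text \<open>
  A Diophantine description of being nonzero with two witnesses. Neither factor can vanish;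
  conversely a power of two can be made congruent to 1 modulo 3 by a change of sign. So, up to signs,
  the power of two in \<open>m\<close> is the second factor and the odd part of \<open>m\<close> is the first.
\<close>

lemma nonzero_iff_product_form: "(m::int) \<noteq> 0 \<longleftrightarrow> (\<exists>a b. m = (2 * a + 1) * (3 * b + 1))"
proof
  show "\<exists>a b. m = (2 * a + 1) * (3 * b + 1)" if "m \<noteq> 0"
    using that
  proof (induction "nat \<bar>m\<bar>" arbitrary: m rule: less_induct)
    case less
    show ?case
    proof (cases "even m")
      case True
      then obtain n where n: "m = 2 * n" by blast
      with less.prems have "nat \<bar>n\<bar> < nat \<bar>m\<bar>" "n \<noteq> 0" by auto
      with less.hyps obtain a b where "n = (2 * a + 1) * (3 * b + 1)" by blast
      \<comment> \<open>Doubling the second factor makes it \<open>-1\<close> modulo 3; changing both signs repairs this.\<close>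
      then have "m = (2 * (- a - 1) + 1) * (3 * (- 2 * b - 1) + 1)"
        by (simp add: n algebra_simps)
      then show ?thesis by blast
    next
      case False
      then obtain a where "m = 2 * a + 1" by (rule oddE)
      then have "m = (2 * a + 1) * (3 * 0 + 1)" by simp
      then show ?thesis by blast
    qed
  qed
next
  show "m \<noteq> 0" if "\<exists>a b. m = (2 * a + 1) * (3 * b + 1)"
  proof -
    from that obtain a b where "m = (2 * a + 1) * (3 * b + 1)" by blast
    moreover have "2 * a + 1 \<noteq> 0" "3 * b + 1 \<noteq> 0" by presburger+
    ultimately show ?thesis by simp
  qed
qed

definition tsquare :: "nat \<Rightarrow> term_list \<Rightarrow> term_list" where
  "tsquare q L = tmul q L L"

lemma teval_tsquare [simp]: "teval q (tsquare q L) x = (teval q L x)\<^sup>2"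
  by (simp add: tsquare_def power2_eq_square)

text \<open>
  The squared distance of the blocks \<open>i\<close> and \<open>j\<close>, where block \<open>i\<close> consists of the \<open>p\<close> variables
  from \<open>i * p\<close> on.
\<close>

definition tdist :: "nat \<Rightarrow> nat \<Rightarrow> nat \<Rightarrow> nat \<Rightarrow> term_list" where
  "tdist q p i j = concat (map (\<lambda>k.
     tsquare q (tminus (tlinear (i * p + k) 1 0) (tlinear (j * p + k) 1 0))) [0..<p])"

lemma block_index_less:
  fixes i k p c :: nat
  assumes "i < c" "k < p"
  shows "i * p + k < c * p"
proof -
  have "i * p + k < Suc i * p" using assms by simp
  also have "\<dots> \<le> c * p" using assms by (intro mult_le_mono1) simp
  finally show ?thesis .
qed

lemma sum_list_upt: "(\<Sum>i\<leftarrow>[0..<n]. f i) = (\<Sum>i<n. f i)" for f :: "nat \<Rightarrow> int"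
  by (simp add: sum_list_distinct_conv_sum_set atLeast0LessThan)

lemma teval_tdist:
  assumes "i < c" "j < c" "c * p \<le> q"
  shows "teval q (tdist q p i j) x = (\<Sum>k<p. (x (i * p + k) - x (j * p + k))\<^sup>2)"
proof -
  have "i * p + k < q \<and> j * p + k < q" if "k < p" for k
    using block_index_less[OF assms(1) that] block_index_less[OF assms(2) that] assms(3) by linarith
  then show ?thesis
    unfolding tdist_def teval_concat sum_list_upt[symmetric]
    by (intro arg_cong[where f = sum_list]) auto
qed

definition distinct_blocks :: "nat \<Rightarrow> nat \<Rightarrow> nat \<Rightarrow> term_list" where
  "distinct_blocks q p c =
     tprod q (concat (map (\<lambda>i. map (\<lambda>j. tdist q p i j) [0..<i]) [0..<c]))"

lemma teval_distinct_blocks_nonzero_iff: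
  assumes "c * p \<le> q"
  shows "teval q (distinct_blocks q p c) x \<noteq> 0 \<longleftrightarrow>
    (\<forall>i<c. \<forall>j<i. \<exists>k<p. x (i * p + k) \<noteq> x (j * p + k))"
proof -
  have "teval q (distinct_blocks q p c) x \<noteq> 0 \<longleftrightarrow>
      (\<forall>i<c. \<forall>j<i. teval q (tdist q p i j) x \<noteq> 0)"
    unfolding distinct_blocks_def teval_tprod prod_list_zero_iff by (fastforce simp: image_iff)
  also have "\<dots> \<longleftrightarrow> (\<forall>i<c. \<forall>j<i. \<exists>k<p. x (i * p + k) \<noteq> x (j * p + k))"
    using assms by (auto simp: teval_tdist[of _ c] sum_nonneg_eq_0_iff)
  finally show ?thesis .
qed

lemma teval_distinct_blocks_cong:
  assumes "c * p \<le> q" "\<And>v. v < c * p \<Longrightarrow> x v = y v"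
  shows "teval q (distinct_blocks q p c) x = teval q (distinct_blocks q p c) y"
proof -
  have "teval q (tdist q p i j) x = teval q (tdist q p i j) y" if "i < c" "j < c" for i j
    unfolding teval_tdist[OF that assms(1)]
    using assms(2) block_index_less[OF that(1)] block_index_less[OF that(2)] by (intro sum.cong) auto
  then show ?thesis
    unfolding distinct_blocks_def teval_tprod
    by (intro arg_cong[where f = prod_list] map_cong) auto
qed

text \<open>
  The variables are \<open>c\<close> blocks of size \<open>p\<close>, each holding a candidate solution, followed by the two
  witnesses for the product of all mutual distances being nonzero. Being a sum of squares, the
  polynomial vanishes exactly if every block is a solution and the product condition holds.
\<close>

definition many_solutions_poly :: "nat \<Rightarrow> term_list \<Rightarrow> nat \<Rightarrow> term_list" where
  "many_solutions_poly p L c =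
     concat (map (\<lambda>i. tsquare (c * p + 2) (tshift p (i * p) L)) [0..<c]) @
     tsquare (c * p + 2) (tminus (distinct_blocks (c * p + 2) p c)
       (tmul (c * p + 2) (tlinear (c * p) 2 1) (tlinear (c * p + 1) 3 1)))"

lemma teval_many_solutions_poly_eq_0_iff:
  "teval (c * p + 2) (many_solutions_poly p L c) x = 0 \<longleftrightarrow>
    (\<forall>i<c. teval p L (\<lambda>k. x (i * p + k)) = 0) \<and>
    teval (c * p + 2) (distinct_blocks (c * p + 2) p c) x =
      (2 * x (c * p) + 1) * (3 * x (c * p + 1) + 1)"
proof -
  let ?q = "c * p + 2"
  have "i * p + p \<le> ?q" if "i < c" for i
    using mult_le_mono1[of "Suc i" c p] that by simp
  then have "teval ?q (concat (map (\<lambda>i. tsquare ?q (tshift p (i * p) L)) [0..<c])) x =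
      (\<Sum>i<c. (teval p L (\<lambda>k. x (i * p + k)))\<^sup>2)"
    unfolding teval_concat
    by (auto simp: sum_list_upt[symmetric] teval_tshift intro!: arg_cong[where f = sum_list])
  moreover have "(\<Sum>i<c. (teval p L (\<lambda>k. x (i * p + k)))\<^sup>2) \<ge> 0" by (simp add: sum_nonneg)
  ultimately show ?thesis
    by (auto simp: many_solutions_poly_def add_nonneg_eq_0_iff sum_nonneg_eq_0_iff)
qed

text \<open>
  From distinct solutions \<open>s\<close>, the blocks are filled first. Their product of distances is then a
  fixed nonzero number, and the last two variables take the witnesses for it.
\<close>

lemma many_solutions_poly_solvable_iff:
  "(\<exists>x. teval (c * p + 2) (many_solutions_poly p L c) x = 0) \<longleftrightarrow>
    (\<exists>s :: nat \<Rightarrow> nat \<Rightarrow> int. (\<forall>i<c. teval p L (s i) = 0) \<and>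
      (\<forall>i<c. \<forall>j<i. \<exists>k<p. s i k \<noteq> s j k))" (is "?L \<longleftrightarrow> ?R")
proof
  assume ?L
  then obtain x where "teval (c * p + 2) (many_solutions_poly p L c) x = 0" ..
  note x = this[unfolded teval_many_solutions_poly_eq_0_iff]
  then have "teval (c * p + 2) (distinct_blocks (c * p + 2) p c) x \<noteq> 0"
    unfolding nonzero_iff_product_form by blast
  then have "\<forall>i<c. \<forall>j<i. \<exists>k<p. x (i * p + k) \<noteq> x (j * p + k)"
    by (subst (asm) teval_distinct_blocks_nonzero_iff) auto
  with x show ?R
    by (intro exI[of _ "\<lambda>i k. x (i * p + k)"]) simp
next
  assume ?R
  then obtain s :: "nat \<Rightarrow> nat \<Rightarrow> int" where s: "\<And>i. i < c \<Longrightarrow> teval p L (s i) = 0"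
    and neq: "\<And>i j. i < c \<Longrightarrow> j < i \<Longrightarrow> \<exists>k<p. s i k \<noteq> s j k" by blast
  define y where "y v = s (v div p) (v mod p)" for v
  have y: "y (i * p + k) = s i k" if "k < p" for i k
    using that by (simp add: y_def)
  have q: "c * p \<le> c * p + 2" by simp
  have "teval (c * p + 2) (distinct_blocks (c * p + 2) p c) y \<noteq> 0"
    unfolding teval_distinct_blocks_nonzero_iff[OF q] using neq y by metis
  then obtain a b where ab: "teval (c * p + 2) (distinct_blocks (c * p + 2) p c) y =
      (2 * a + 1) * (3 * b + 1)"
    unfolding nonzero_iff_product_form by blast
  define x where "x = y(c * p := a, c * p + 1 := b)"
  have x: "x v = y v" if "v < c * p" for v
    using that by (simp add: x_def)
  have "teval p L (\<lambda>k. x (i * p + k)) = 0" if "i < c" for i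
  proof -
    have "teval p L (\<lambda>k. x (i * p + k)) = teval p L (s i)"
      using x y block_index_less[OF that] by (intro teval_cong) simp
    with s[OF that] show ?thesis by simp
  qed
  moreover have "teval (c * p + 2) (distinct_blocks (c * p + 2) p c) x =
      teval (c * p + 2) (distinct_blocks (c * p + 2) p c) y"
    using q x by (rule teval_distinct_blocks_cong)
  moreover have "\<dots> = (2 * x (c * p) + 1) * (3 * x (c * p + 1) + 1)"
    unfolding ab by (simp add: x_def)
  ultimately show ?L
    using teval_many_solutions_poly_eq_0_iff by metis
qed

text \<open>
  Any \<open>c\<close> distinct vectors that solve the equation give a subset of the solution set with \<open>c\<close>
  elements, and such a subset exists exactly if the solution set is infinite or large enough.
\<close>

lemma ex_distinct_solutions_iff:
  fixes p :: nat and L :: term_list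
  defines "S \<equiv> int_solutions (p, mpoly_of p L)"
  shows "(\<exists>s :: nat \<Rightarrow> nat \<Rightarrow> int. (\<forall>i<c. teval p L (s i) = 0) \<and>
      (\<forall>i<c. \<forall>j<i. \<exists>k<p. s i k \<noteq> s j k)) \<longleftrightarrow> infinite S \<or> c \<le> card S" (is "?L \<longleftrightarrow> ?R")
proof
  assume ?L
  then obtain s :: "nat \<Rightarrow> nat \<Rightarrow> int" where s: "\<And>i. i < c \<Longrightarrow> teval p L (s i) = 0"
    and neq: "\<And>i j. i < c \<Longrightarrow> j < i \<Longrightarrow> \<exists>k<p. s i k \<noteq> s j k" by blast
  define t where "t i = map (s i) [0..<p]" for i
  have "t i \<in> S" if "i < c" for i
  proof -
    have "teval p L ((!) (t i)) = teval p L (s i)" by (rule teval_cong) (simp add: t_def)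
    with s[OF that] show ?thesis
      by (simp add: S_def int_solutions_def mpoly_eval_mpoly_of t_def)
  qed
  then have sub: "t ` {..<c} \<subseteq> S" by auto
  have diff: "t i \<noteq> t j" if "i < c" "j < i" for i j
    using neq[OF that] by (auto simp: t_def)
  have "inj_on t {..<c}"
    by (rule linorder_inj_onI) (use diff in force)+
  then have "card (t ` {..<c}) = c" by (simp add: card_image)
  with sub show ?R by (metis card_mono)
next
  assume ?R
  then obtain T where T: "T \<subseteq> S" "finite T" "card T = c"
    by (metis infinite_arbitrarily_large obtain_subset_with_card_n)
  then obtain t where t: "bij_betw t {..<c} T"
    by (metis bij_betw_iff_card finite_lessThan card_lessThan)
  define s where "s i k = t i ! k" for i k
  have len: "length (t i) = p" and zero: "teval p L (s i) = 0" if "i < c" for i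
  proof -
    have "t i \<in> S" using t T(1) that by (auto simp: bij_betw_def)
    then show "length (t i) = p" "teval p L (s i) = 0"
      by (auto simp: S_def int_solutions_def mpoly_eval_mpoly_of s_def[abs_def])
  qed
  have "\<exists>k<p. s i k \<noteq> s j k" if "i < c" "j < i" for i j
  proof (rule ccontr)
    assume "\<not> (\<exists>k<p. s i k \<noteq> s j k)"
    moreover have "j < c" using that by simp
    ultimately have "t i = t j" using len that by (intro nth_equalityI) (auto simp: s_def)
    with \<open>j < c\<close> that have "i = j"
      using inj_onD[OF bij_betw_imp_inj_on[OF t], of i j] by simp
    with that show False by simp
  qed
  with zero show ?L by blast
qed

text \<open>
  The heart of the matter: a finite solution set has fewer than \<open>c\<close> elements by the choice of \<open>c\<close>,
  whereas an infinite one contains \<open>c\<close> distinct elements. So finiteness amounts to the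
  unsolvability of the single equation that asks for \<open>c\<close> distinct solutions.
\<close>

lemma finitely_solvable_iff:
  assumes e: "e \<in> dioph_eqs" and c: "finite (int_solutions e) \<Longrightarrow> card (int_solutions e) < c"
  defines "p \<equiv> decode_arity (eq_code e)" and "L \<equiv> decode_terms (eq_code e)"
  shows "eq_code e \<in> finitely_solvable_codes \<longleftrightarrow>
    poly_code (c * p + 2) (many_solutions_poly p L c) \<notin> solvable_codes"
proof -
  have pL: "(p, mpoly_of p L) = e"
    unfolding p_def L_def using e by (cases e) (simp add: mpoly_of_decode_terms)
  have "poly_code (c * p + 2) (many_solutions_poly p L c) \<in> solvable_codes \<longleftrightarrow>
      infinite (int_solutions e) \<or> c \<le> card (int_solutions e)"
    using ex_distinct_solutions_iff[of c p L] many_solutions_poly_solvable_iff[of c p L]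
    by (simp add: poly_code_in_solvable_codes_iff pL del: One_nat_def)
  moreover have "eq_code e \<in> finitely_solvable_codes \<longleftrightarrow> finite (int_solutions e)"
    unfolding finitely_solvable_codes_def using e by (auto dest: inj_onD[OF inj_on_eq_code])
  ultimately show ?thesis using c by fastforce
qed

section \<open>Computability of the construction\<close>

lemma computable_prod_decode [computable_intros]:
  "computable A f \<Longrightarrow> computable A (\<lambda>x. prod_decode (f x))"
  by (erule computable_recode) (auto simp: enc_prod_def)

lemma computable_term_decode [computable_intros]:
  "computable A f \<Longrightarrow> computable A (\<lambda>x. term_decode (f x))"
  by (erule computable_recode) auto

lemma computable_decode_terms [computable_intros]:
  assumes "computable A f"
  shows "computable A (\<lambda>x. decode_terms (f x))"
  unfolding decode_terms_def by (intro computable_intros assms)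

lemma computable_decode_arity [computable_intros]:
  assumes "computable A f"
  shows "computable A (\<lambda>x. decode_arity (f x))"
  unfolding decode_arity_def by (intro computable_intros assms)

lemma computable_pad [computable_intros]:
  assumes "computable A q" "computable A f"
  shows "computable A (\<lambda>x. pad (q x) (f x))"
  unfolding pad_def by (intro computable_intros computable_compose[OF assms(2)] assms(1))

lemma computable_poly_code [computable_intros]:
  assumes "computable A q" "computable A f"
  shows "computable A (\<lambda>x. poly_code (q x) (f x))"
proof -
  note intros = computable_intros computable_compose[OF assms(1)] computable_compose[OF assms(2)]
  have "computable A (\<lambda>x. enc (q x, set_encode (set (map enc (filter (\<lambda>t. snd t \<noteq> 0)
     (map (\<lambda>t. (pad (q x) (fst t), tcoeff (q x) (f x) (pad (q x) (fst t)))) (f x)))))))"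
    unfolding tcoeff_def by (intro intros assms)
  then show ?thesis by (simp add: poly_code_eq enc_Pair)
qed

lemma computable_tmul [computable_intros]:
  assumes "computable A q" "computable A f" "computable A g"
  shows "computable A (\<lambda>x. tmul (q x) (f x) (g x))"
  unfolding tmul_def
  by (intro computable_intros computable_compose[OF assms(1)] computable_compose[OF assms(3)] assms)

lemma computable_tsquare [computable_intros]:
  assumes "computable A q" "computable A f"
  shows "computable A (\<lambda>x. tsquare (q x) (f x))"
  unfolding tsquare_def by (intro computable_intros assms)

lemma computable_tminus [computable_intros]:
  assumes "computable A f" "computable A g"
  shows "computable A (\<lambda>x. tminus (f x) (g x))"
  unfolding tminus_def by (intro computable_intros assms)

lemma computable_tprod [computable_intros]:
  assumes "computable A q" "computable A f"
  shows "computable A (\<lambda>x. tprod (q x) (f x))"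
  unfolding tprod_def by (intro computable_intros computable_compose[OF assms(1)] assms(2))

lemma computable_tlinear [computable_intros]:
  assumes "computable A i" "computable A a" "computable A b"
  shows "computable A (\<lambda>x. tlinear (i x) (a x) (b x))"
  unfolding tlinear_def by (intro computable_intros assms)

lemma computable_tshift [computable_intros]:
  assumes "computable A p" "computable A k" "computable A f"
  shows "computable A (\<lambda>x. tshift (p x) (k x) (f x))"
  unfolding tshift_def
  by (intro computable_intros computable_compose[OF assms(1)] computable_compose[OF assms(2)] assms(3))

lemma computable_many_solutions_poly [computable_intros]:
  assumes "computable A p" "computable A f" "computable A c"
  shows "computable A (\<lambda>x. many_solutions_poly (p x) (f x) (c x))"
  unfolding many_solutions_poly_def distinct_blocks_def tdist_def
  by (intro computable_intros computable_compose[OF assms(1)] computable_compose[OF assms(2)]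
      computable_compose[OF assms(3)] assms)

lemma computable_valid_code [computable_intros]:
  assumes "computable A f"
  shows "computable A (\<lambda>x. valid_code (f x))"
  unfolding valid_code_def by (intro computable_intros assms)

lemma computable_query [computable_intros]:
  assumes "computable A f"
  shows "computable A (\<lambda>x. f x \<in> A)"
  by (rule computable_compose[OF _ assms], rule computableI[where r = Query])
     (simp add: enc_bool_def)

section \<open>The reduction\<close>

lemma run_query_free: "query_free r \<Longrightarrow> run A r xs = run B r xs"
proof (induction r arbitrary: xs)
  case (Comp f gs)
  have "map (\<lambda>g. run A g xs) gs = map (\<lambda>g. run B g xs) gs"
    using Comp by (intro map_cong) auto
  moreover have "run A f = run B f"
    using Comp by (auto simp: fun_eq_iff)
  ultimately show ?case by (simp only: run.simps)
next
  case (PrimRec f g)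
  then have "run A f = run B f" "run A g = run B g" by (auto simp: fun_eq_iff)
  then show ?case by (simp only: run.simps)
next
  case (Mu f)
  then have "run A f = run B f" by (auto simp: fun_eq_iff)
  then show ?case by (simp only: run.simps)
qed simp_all

theorem theorem11:
  assumes "\<exists>r. computes_solution_bound r"
  shows "decidable_relative_to solvable_codes finitely_solvable_codes"
proof -
  obtain r where r: "query_free r"
    and bound: "\<And>e. e \<in> dioph_eqs \<Longrightarrow> \<exists>c. run {} r [eq_code e] = Some c \<and>
      (finite (int_solutions e) \<longrightarrow> card (int_solutions e) < c)"
    using assms unfolding computes_solution_bound_def by blast
  (* The program r may diverge outside the codes, so every other input is replaced by the code
     of the trivial equation in one variable. *)
  define n0 where "n0 = poly_code 1 []"
  define guard where "guard n = (if valid_code n then n else n0)" for n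
  define bnd where "bnd n = the (run {} r [guard n])" for n
  have guard: "guard n \<in> eq_code ` dioph_eqs" for n
    unfolding guard_def valid_code_iff n0_def poly_code_def
    using mpoly_of_in_dioph_eqs[of 1 "[]"] by auto
  have run_bnd: "run {} r [guard n] = Some (bnd n)" for n
    using guard[of n] bound unfolding bnd_def by force
  have "computable solvable_codes guard"
    unfolding guard_def by (intro computable_intros)
  then obtain s where s: "\<And>n. run solvable_codes s [n] = Some (guard n)"
    unfolding computable_def by auto
  have "computable solvable_codes bnd"
    by (rule computableI[where r = "Comp r [s]"])
       (simp add: s run_query_free[OF r, of solvable_codes _ "{}"] run_bnd)
  note bnd = computable_compose[OF this]
  let ?p = decode_arity and ?L = decode_terms
  have "computable solvable_codes (\<lambda>n. valid_code n \<and>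
      poly_code (bnd n * ?p n + 2) (many_solutions_poly (?p n) (?L n) (bnd n)) \<notin> solvable_codes)"
    by (intro computable_intros bnd)
  moreover have "(valid_code n \<and>
      poly_code (bnd n * ?p n + 2) (many_solutions_poly (?p n) (?L n) (bnd n)) \<notin> solvable_codes) \<longleftrightarrow>
      n \<in> finitely_solvable_codes" for n
  proof (cases "valid_code n")
    case True
    then obtain e where e: "e \<in> dioph_eqs" "n = eq_code e" by (auto simp: valid_code_iff)
    have "finite (int_solutions e) \<Longrightarrow> card (int_solutions e) < bnd n"
      using bound[OF e(1)] run_bnd[of n] True by (auto simp: guard_def e(2))
    from finitely_solvable_iff[OF e(1) this] True show ?thesis by (simp add: e(2))
  next
    case False
    then show ?thesis by (auto simp: valid_code_iff finitely_solvable_codes_def)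
  qed
  ultimately have "computable solvable_codes (\<lambda>n. n \<in> finitely_solvable_codes)" by simp
  then show ?thesis
    by (simp add: computable_def decidable_relative_to_def enc_bool_def)
qed

end
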